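(* For every additive complement $\mathcal{W}$ of the squares, $$\sum_{n\le N} f_2(n)-N\ge N^{3/4}\exp\left(-\left(\frac{\log 2}{2}+o(1)\right)\frac{\log N}{\log\log N}\right)$$ as $N\to\infty$. In particular, for every fixed $\varepsilon>0$, $$\sum_{n\le N} f_2(n)-N\gg N^{3/4-\varepsilon}$$ for all sufficiently large $N$.
   Context: $\mathbb{N}=\{1,2,3,\dots\}$ and $\mathcal{S}=\{1^2,2^2,3^2,\dots\}$ is the set of squares. A set $\mathcal{W}\subset\mathbb{N}$ is an additive complement of the squares if all sufficiently large integers can be written as the sum of an element of $\mathcal{W}$ and an element of $\mathcal{S}$. For such $\mathcal{W}$, $f_2(n)=\#\{(w,m^2)\in\mathcal{W}\times\mathcal{S}: n=w+m^2\}$. Sums over $n\le N$ run over integers $1\le n\le N$. $\log$ is the natural logarithm. Here $o(1)$ denotes a function of $N$ (which may depend on $\mathcal{W}$) tending to $0$ as $N\to\infty$, the inequality being asserted for all sufficiently large $N$. The notation $F(N)\gg G(N)$ means $F(N)\ge C\,G(N)$ for some constant $C>0$, which may depend on $\mathcal{W}$ and $\varepsilon$. *)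

theory Defs
  imports Complex_Main
begin

text \<open>
  The positive integers are represented by the nonzero elements of type \<^typ>\<open>nat\<close>;
  in particular 0 is neither a square nor an element of an additive complement.
\<close>

definition squares :: "nat set" where
  "squares = {m ^ 2 | m. 1 \<le> m}"

definition additive_complement_of_squares :: "nat set \<Rightarrow> bool" where
  "additive_complement_of_squares W \<longleftrightarrow>
     W \<subseteq> {1..} \<and> (\<forall>\<^sub>F n in sequentially. \<exists>w\<in>W. \<exists>s\<in>squares. n = w + s)"

definition f2 :: "nat set \<Rightarrow> nat \<Rightarrow> nat" where
  "f2 W n = card {(w, s) \<in> W \<times> squares. n = w + s}"

end

theory Submission
  imports Defs "HOL-Analysis.Convex" "HOL-Computational_Algebra.Primes" "HOL-Real_Asymp.Real_Asymp"
begin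

text \<open>
  Two elements v < w of W with w - v = 4 a c and a \<noteq> c force a collision
  v + (a + c)^2 = w + (a - c)^2. For each a up to t, comparable to sqrt N, the pigeonhole principle in the
  residue classes modulo 4 a gives about t such pairs, so there are about N collisions at values
  n \<le> N. On the other hand two distinct values n, n' have at most D common elements w, where D
  bounds the number of divisors of n' - n. By a Cauchy-Schwarz argument the n with more than
  B \<approx> N^(1/4) sqrt D representations therefore account for few collisions, and the remaining n account
  for at most O(B) times the excess. Hence the excess is at least about N / B = N^(3/4) / sqrt D,
  and Wigert's bound D \<le> exp ((ln 2 + o(1)) ln N / ln ln N) finishes the proof.
\<close>

subsection \<open>Wigert's bound for the number of divisors\<close>

text \<open>A divisor is determined by its exponents at the primes of \<open>n\<close>, and each
  exponent is at most the one in \<open>n\<close>.\<close>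

lemma card_divisors_le_prod:
  fixes n :: nat
  assumes "n > 0"
  shows "card {d. d dvd n} \<le> (\<Prod>p\<in>prime_factors n. multiplicity p n + 1)"
proof -
  let ?f = "\<lambda>d. restrict (\<lambda>p. multiplicity p d) (prime_factors n)"
  let ?T = "\<Pi>\<^sub>E p\<in>prime_factors n. {..multiplicity p n}"
  have "inj_on ?f {d. d dvd n}"
  proof (rule inj_onI, clarify)
    fix d e assume d: "d dvd n" and e: "e dvd n" and eq: "?f d = ?f e"
    have pos: "d > 0" "e > 0" using d e assms by (auto intro: Nat.gr0I)
    show "d = e"
    proof (rule multiplicity_eq_nat[OF pos])
      fix p :: nat assume p: "prime p"
      show "multiplicity p d = multiplicity p e"
      proof (cases "p \<in> prime_factors n")
        case True
        then show ?thesis using fun_cong[OF eq, of p] by simp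
      next
        case False
        then have "\<not> p dvd n" using p assms by (simp add: prime_factors_dvd)
        then have "\<not> p dvd d" "\<not> p dvd e" using d e dvd_trans by blast+
        then show ?thesis by (simp add: not_dvd_imp_multiplicity_0)
      qed
    qed
  qed
  moreover have "?f ` {d. d dvd n} \<subseteq> ?T"
    using assms by (auto intro!: dvd_imp_multiplicity_le)
  moreover have "finite ?T" by (intro finite_PiE) auto
  ultimately have "card {d. d dvd n} \<le> card ?T"
    by (rule card_inj_on_le)
  then show ?thesis by (simp add: card_PiE)
qed

text \<open>Split the product over primes at \<open>P\<close>. At most \<open>P\<close> primes lie
  below it, each with a factor at most \<open>1 + ln x / ln 2\<close>. For the others
  \<open>m + 1 <= 2 ^ m\<close>, and their exponents add up to at most \<open>ln x / ln P\<close>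
  because \<open>P\<close> to the power of that sum is at most \<open>n\<close>.\<close>

lemma card_divisors_le:
  fixes n :: nat and P x :: real
  assumes n: "n > 0" "real n \<le> x" and P: "P > 1"
  shows "real (card {d. d dvd n}) \<le> exp (P * ln (1 + ln x / ln 2) + ln 2 * (ln x / ln P))"
proof -
  define m where "m p = multiplicity p n" for p
  let ?F = "prime_factors n"
  let ?A = "{p\<in>?F. real p < P}" and ?B = "{p\<in>?F. \<not> real p < P}"
  have x1: "x \<ge> 1" using n by linarith
  have pr: "2 \<le> p" if "p \<in> ?F" for p using that by (simp add: in_prime_factors_iff prime_ge_2_nat)
  have npow: "(\<Prod>p\<in>G. p ^ m p) \<le> n" if "G \<subseteq> ?F" for G
  proof -
    have "(\<Prod>p\<in>G. p ^ m p) dvd (\<Prod>p\<in>?F. p ^ m p)"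
      using that by (intro prod_dvd_prod_subset) auto
    also have "\<dots> = n" unfolding m_def using prime_factorization_nat[OF n(1)] by simp
    finally show ?thesis using n(1) by (rule dvd_imp_le)
  qed
  have mle: "real (m p) \<le> ln x / ln 2" if p: "p \<in> ?F" for p
  proof -
    have "2 ^ m p \<le> p ^ m p" using pr[OF p] by (simp add: power_mono)
    also have "\<dots> \<le> n" using npow[of "{p}"] p by simp
    finally have "(2::real) ^ m p \<le> x" using n(2)
      by (metis numeral_power_le_of_nat_cancel_iff order_trans)
    then have "ln ((2::real) ^ m p) \<le> ln x" by (subst ln_le_cancel_iff) (use x1 in auto)
    then show ?thesis by (simp add: ln_realpow field_simps)
  qed
  have A: "(\<Prod>p\<in>?A. real (m p + 1)) \<le> exp (P * ln (1 + ln x / ln 2))"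
  proof -
    have ge: "1 \<le> 1 + ln x / ln 2" using x1 by simp
    have "?A \<subseteq> {1..nat \<lfloor>P\<rfloor>}"
      using pr by (force simp: le_nat_floor)
    then have "card ?A \<le> nat \<lfloor>P\<rfloor>" using card_mono[of "{1..nat \<lfloor>P\<rfloor>}" ?A] by simp
    then have c: "real (card ?A) \<le> P" using P by linarith
    have "(\<Prod>p\<in>?A. real (m p + 1)) \<le> (\<Prod>p\<in>?A. 1 + ln x / ln 2)"
      by (intro prod_mono) (use mle in force)
    also have "\<dots> = exp (card ?A * ln (1 + ln x / ln 2))"
      using ge by (simp add: exp_of_nat_mult)
    also have "\<dots> \<le> exp (P * ln (1 + ln x / ln 2))"
      using c ge by (simp add: mult_right_mono)
    finally show ?thesis .
  qed
  have B: "(\<Prod>p\<in>?B. real (m p + 1)) \<le> exp (ln 2 * (ln x / ln P))"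
  proof -
    define S where "S = (\<Sum>p\<in>?B. m p)"
    have "P ^ S = (\<Prod>p\<in>?B. P ^ m p)" by (simp add: S_def power_sum)
    also have "\<dots> \<le> (\<Prod>p\<in>?B. real p ^ m p)"
      using P by (intro prod_mono) (auto intro: power_mono)
    also have "\<dots> = real (\<Prod>p\<in>?B. p ^ m p)" by simp
    also have "\<dots> \<le> real n" using npow[of ?B] by (intro of_nat_mono) auto
    finally have "P ^ S \<le> x" using n by linarith
    then have "ln (P ^ S) \<le> ln x" using P x1 by (subst ln_le_cancel_iff) auto
    then have S: "real S \<le> ln x / ln P" using P by (simp add: ln_realpow field_simps)
    have "(\<Prod>p\<in>?B. real (m p + 1)) \<le> (\<Prod>p\<in>?B. 2 ^ m p)"
    proof (intro prod_mono conjI)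
      fix p
      have "m p + 1 \<le> 2 ^ m p" using less_exp[of "m p"] by linarith
      then show "real (m p + 1) \<le> 2 ^ m p"
        by (metis of_nat_le_iff of_nat_numeral of_nat_power)
    qed auto
    also have "\<dots> = 2 ^ S" by (simp add: S_def power_sum)
    also have "\<dots> = exp (ln 2 * real S)"
      by (metis exp_ln exp_of_nat_mult mult.commute zero_less_numeral)
    also have "\<dots> \<le> exp (ln 2 * (ln x / ln P))" using mult_left_mono[OF S, of "ln 2"] by simp
    finally show ?thesis .
  qed
  have "real (card {d. d dvd n}) \<le> real (\<Prod>p\<in>?F. m p + 1)"
    using card_divisors_le_prod[OF n(1)] unfolding m_def by (rule of_nat_mono)
  also have "\<dots> = (\<Prod>p\<in>?F. real (m p + 1))" by simp
  also have "\<dots> = (\<Prod>p\<in>?A. real (m p + 1)) * (\<Prod>p\<in>?B. real (m p + 1))"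
    by (subst prod.union_disjoint[symmetric]) (auto intro: prod.cong)
  also have "\<dots> \<le> exp (P * ln (1 + ln x / ln 2)) * exp (ln 2 * (ln x / ln P))"
    by (intro mult_mono A B prod_nonneg) auto
  finally show ?thesis by (simp add: exp_add)
qed

text \<open>With this threshold P between small and large primes, ln P is asymptotic to ln (ln x) while the
  contribution of the small primes stays negligible.\<close>
definition divisor_exponent :: "real \<Rightarrow> real" where
  "divisor_exponent x =
     (let P = ln x / ln (ln x) ^ 3 in P * ln (1 + ln x / ln 2) + ln 2 * (ln x / ln P))"

text \<open>The halving stems from \<open>sqrt D\<close> with
  \<open>D = exp (divisor_exponent N)\<close>; the limit is the constant in the exponent of the
  theorem.\<close>

lemma divisor_exponent_asymp:
  "((\<lambda>x. divisor_exponent x / 2 * (ln (ln x) / ln x)) \<longlongrightarrow> ln 2 / 2) at_top"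
  unfolding divisor_exponent_def Let_def by real_asymp

lemma eventually_divisor_exponent_nonneg: "eventually (\<lambda>x. divisor_exponent x \<ge> 0) at_top"
  unfolding divisor_exponent_def Let_def by real_asymp

lemma divisor_exponent_le_ln:
  assumes "\<epsilon> > 0"
  shows "eventually (\<lambda>x. divisor_exponent x / 2 \<le> \<epsilon> * ln x) at_top"
proof -
  have "((\<lambda>x. divisor_exponent x / 2 / ln x) \<longlongrightarrow> 0) at_top"
    unfolding divisor_exponent_def Let_def by real_asymp
  then have "eventually (\<lambda>x. divisor_exponent x / 2 / ln x < \<epsilon>) at_top"
    using assms by (rule order_tendstoD)
  moreover have "eventually (\<lambda>x::real. x > 1) at_top" by (rule eventually_gt_at_top)
  ultimately show ?thesis by eventually_elim (simp add: field_simps)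
qed

text \<open>Lets the main term dominate the additive loss \<open>n0\<close> of
  \<open>sum_excess_le\<close>.\<close>

lemma divisor_exponent_at_top:
  "filterlim (\<lambda>x. x powr (3 / 4) * exp (- divisor_exponent x / 2)) at_top at_top"
  unfolding divisor_exponent_def Let_def by real_asymp

lemma eventually_card_divisors_le:
  "\<forall>\<^sub>F N in sequentially. \<forall>d. 0 < d \<longrightarrow> d \<le> N \<longrightarrow>
     real (card {u. u dvd d}) \<le> exp (divisor_exponent (real N))"
proof -
  have "eventually (\<lambda>x::real. ln x / ln (ln x) ^ 3 > 1) at_top" by real_asymp
  then have "\<forall>\<^sub>F N in sequentially. ln (real N) / ln (ln (real N)) ^ 3 > 1"
    using filterlim_real_sequentially by (rule eventually_compose_filterlim)
  then show ?thesis
    unfolding divisor_exponent_def Let_def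
    by eventually_elim (intro allI impI card_divisors_le, simp_all)
qed

subsection \<open>Collisions\<close>

lemma card_congruent_pairs_ge:
  fixes X :: "nat set"
  assumes "finite X" "q > 0"
  shows "(card X)\<^sup>2 \<le> q * card {(v, w). v \<in> X \<and> w \<in> X \<and> v mod q = w mod q}"
proof -
  define Y where "Y r = {x\<in>X. x mod q = r}" for r
  have fin: "finite (Y r)" for r using assms by (simp add: Y_def)
  have "card X = card (\<Union>r<q. Y r)"
    using assms by (intro arg_cong[where f = card]) (auto simp: Y_def)
  also have "\<dots> = (\<Sum>r<q. card (Y r))"
    using fin by (intro card_UN_disjoint) (auto simp: Y_def)
  finally have "(real (card X))\<^sup>2 = (\<Sum>r<q. real (card (Y r)))\<^sup>2" by simp
  \<comment> \<open>Cauchy-Schwarz over the \<open>q\<close> residue classes; the squares then count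
    ordered congruent pairs, diagonal included.\<close>
  also have "\<dots> \<le> (\<Sum>r<q. (real (card (Y r)))\<^sup>2) * real (card {..<q})"
    by (rule sum_squared_le_sum_of_squares)
  also have "(\<Sum>r<q. (real (card (Y r)))\<^sup>2) = real (card (\<Union>r<q. Y r \<times> Y r))"
    using fin by (subst card_UN_disjoint) (auto simp: Y_def card_cartesian_product power2_eq_square)
  also have "(\<Union>r<q. Y r \<times> Y r) = {(v, w). v \<in> X \<and> w \<in> X \<and> v mod q = w mod q}"
    using assms by (auto simp: Y_def)
  finally have "real ((card X)\<^sup>2) \<le>
      real (q * card {(v, w). v \<in> X \<and> w \<in> X \<and> v mod q = w mod q})"
    by (simp add: mult.commute)
  then show ?thesis by (simp only: of_nat_le_iff)
qed

text \<open>Cauchy-Schwarz over \<open>V\<close>, applied to the number of sets \<open>R n\<close>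
  that contain a given \<open>w\<close>. Expanding the squares gives the sum of all
  \<open>card (R n \<inter> R n')\<close>: the diagonal contributes the incidences themselves, every
  other pair at most \<open>D\<close>.\<close>

lemma card_incidences_squared_le:
  fixes R :: "'a \<Rightarrow> 'b set" and D :: real
  assumes fin: "finite S" "finite V" and R: "\<And>n. n \<in> S \<Longrightarrow> R n \<subseteq> V"
    and codeg: "\<And>n n'. n \<in> S \<Longrightarrow> n' \<in> S \<Longrightarrow> n \<noteq> n' \<Longrightarrow> real (card (R n \<inter> R n')) \<le> D"
    and D: "D \<ge> 0"
  shows "(real (\<Sum>n\<in>S. card (R n)))\<^sup>2 \<le> real (card V) * (real (\<Sum>n\<in>S. card (R n)) + D * (real (card S))\<^sup>2)"
proof -
  define i where "i n w = (if w \<in> R n then 1 else 0 :: real)" for n w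
  have card_eq: "real (card (R n)) = (\<Sum>w\<in>V. i n w)" if "n \<in> S" for n
    using R[OF that] fin by (simp add: i_def sum.If_cases Int_absorb1)
  have card2: "real (card (R n \<inter> R n')) = (\<Sum>w\<in>V. i n w * i n' w)" if "n \<in> S" for n n'
  proof -
    have "(\<Sum>w\<in>V. i n w * i n' w) = (\<Sum>w\<in>V. if w \<in> R n \<inter> R n' then 1 else 0)"
      by (rule sum.cong) (auto simp: i_def)
    also have "\<dots> = real (card (R n \<inter> R n'))"
      using R[OF that] fin
      by (subst sum.If_cases) (auto intro!: arg_cong[where f = card])
    finally show ?thesis by simp
  qed
  have "real (\<Sum>n\<in>S. card (R n)) = (\<Sum>n\<in>S. \<Sum>w\<in>V. i n w)"
    using card_eq by simp
  also have "\<dots> = (\<Sum>w\<in>V. \<Sum>n\<in>S. i n w)" by (rule sum.swap)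
  finally have "(real (\<Sum>n\<in>S. card (R n)))\<^sup>2 = (\<Sum>w\<in>V. \<Sum>n\<in>S. i n w)\<^sup>2" by simp
  also have "\<dots> \<le> (\<Sum>w\<in>V. (\<Sum>n\<in>S. i n w)\<^sup>2) * real (card V)"
    using fin sum_squared_le_sum_of_squares by blast
  also have "(\<Sum>w\<in>V. (\<Sum>n\<in>S. i n w)\<^sup>2) = (\<Sum>n\<in>S. \<Sum>n'\<in>S. \<Sum>w\<in>V. i n w * i n' w)"
  proof -
    have "(\<Sum>w\<in>V. (\<Sum>n\<in>S. i n w)\<^sup>2) = (\<Sum>w\<in>V. \<Sum>n\<in>S. \<Sum>n'\<in>S. i n w * i n' w)"
      by (simp add: power2_eq_square sum_product)
    also have "\<dots> = (\<Sum>n\<in>S. \<Sum>w\<in>V. \<Sum>n'\<in>S. i n w * i n' w)" by (rule sum.swap)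
    also have "\<dots> = (\<Sum>n\<in>S. \<Sum>n'\<in>S. \<Sum>w\<in>V. i n w * i n' w)"
      by (intro sum.cong refl sum.swap)
    finally show ?thesis .
  qed
  also have "\<dots> = (\<Sum>n\<in>S. \<Sum>n'\<in>S. real (card (R n \<inter> R n')))"
    by (simp add: card2)
  \<comment> \<open>Adding \<open>D\<close> on the diagonal as well only weakens the bound and makes
    the second term a full square.\<close>
  also have "\<dots> \<le> (\<Sum>n\<in>S. \<Sum>n'\<in>S. (if n = n' then real (card (R n)) else 0) + D)"
    using codeg D by (intro sum_mono) auto
  also have "\<dots> = real (\<Sum>n\<in>S. card (R n)) + D * (real (card S))\<^sup>2"
    using fin by (simp add: sum.distrib power2_eq_square)
  finally show ?thesis by (simp add: mult_ac mult_right_mono)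
qed

section \<open>Representations of one integer and of two integers at once\<close>

lemma f2_eq_card: "f2 W n = card {w\<in>W. \<exists>m\<ge>1. n = w + m\<^sup>2}"
proof -
  have "bij_betw fst {(w, s) \<in> W \<times> squares. n = w + s} {w\<in>W. \<exists>m\<ge>1. n = w + m\<^sup>2}"
    unfolding bij_betw_def inj_on_def squares_def by (force simp: image_iff)
  then show ?thesis unfolding f2_def by (rule bij_betw_same_card)
qed

lemma finite_reps: "finite {w\<in>W. \<exists>m\<ge>1. n = w + (m::nat)\<^sup>2}"
  by (rule finite_subset[of _ "{..n}"]) auto

text \<open>If \<open>n = w + m^2\<close> and \<open>n' = w + m'^2\<close>, then
  \<open>d = m' - m\<close> divides \<open>n' - n\<close> with cofactor \<open>m' + m\<close>. So
  \<open>d\<close> determines \<open>m\<close> as half the difference of cofactor and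
  \<open>d\<close>, and hence \<open>w\<close>.\<close>

lemma card_common_reps_le:
  fixes n n' :: nat
  assumes "n < n'"
  shows "card {w. (\<exists>m. n = w + m\<^sup>2) \<and> (\<exists>m. n' = w + m\<^sup>2)} \<le> card {d. d dvd n' - n}"
proof -
  let ?g = "\<lambda>d. n - (((n' - n) div d - d) div 2)\<^sup>2"
  have fin: "finite {d. d dvd n' - n}" using assms by simp
  have "{w. (\<exists>m. n = w + m\<^sup>2) \<and> (\<exists>m. n' = w + m\<^sup>2)} \<subseteq> ?g ` {d. d dvd n' - n}"
  proof
    fix w assume "w \<in> {w. (\<exists>m. n = w + m\<^sup>2) \<and> (\<exists>m. n' = w + m\<^sup>2)}"
    then obtain m m' where n: "n = w + m\<^sup>2" "n' = w + m'\<^sup>2" by blast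
    have lt: "m < m'" using assms n by (simp add: power2_less_imp_less)
    have eq: "n' - n = (m' - m) * (m' + m)"
      unfolding n using lt by (simp add: power2_eq_square algebra_simps diff_mult_distrib)
    have "(n' - n) div (m' - m) - (m' - m) = 2 * m" using lt by (simp add: eq)
    then have w: "w = ?g (m' - m)" using n by simp
    show "w \<in> ?g ` {d. d dvd n' - n}"
    proof (rule image_eqI)
      show "w = ?g (m' - m)" by (rule w)
      show "m' - m \<in> {d. d dvd n' - n}" by (simp add: eq)
    qed
  qed
  then show ?thesis using fin by (meson card_image_le card_mono finite_imageI order_trans)
qed

section \<open>Pairs of elements that produce a collision\<close>

definition collision_pairs :: "nat \<Rightarrow> nat set \<Rightarrow> (nat \<times> nat) set" where
  "collision_pairs a X = {(v, w). v \<in> X \<and> w \<in> X \<and> v < w \<and> 4 * a dvd w - v \<and> w - v \<noteq> 4 * a\<^sup>2}"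

lemma finite_collision_pairs: "finite X \<Longrightarrow> finite (collision_pairs a X)"
  by (rule finite_subset[of _ "X \<times> X"]) (auto simp: collision_pairs_def)

text \<open>An ordered pair congruent modulo \<open>4 * a\<close> is a collision pair in one of its
  two orders, or lies on the diagonal, or has one of the two excluded differences; each of these
  three exceptional families has at most \<open>card X\<close> members. The size condition on
  \<open>X\<close> lets them cost at most half of the pigeonhole count.\<close>

lemma card_collision_pairs_ge:
  assumes X: "finite X" and a: "a \<ge> 1" and big: "24 * a \<le> card X"
  shows "(card X)\<^sup>2 \<le> 16 * a * card (collision_pairs a X)"
proof -
  let ?K = "collision_pairs a X"
  let ?P = "{(v, w). v \<in> X \<and> w \<in> X \<and> v mod (4 * a) = w mod (4 * a)}"
  let ?f = "\<lambda>v. (v, v)" and ?g = "\<lambda>v. (v, v + 4 * a\<^sup>2)" and ?h = "\<lambda>v. (v + 4 * a\<^sup>2, v)"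
  have fK: "finite ?K" using X by (rule finite_collision_pairs)
  have "?P \<subseteq> ?K \<union> prod.swap ` ?K \<union> ?f ` X \<union> ?g ` X \<union> ?h ` X"
  proof clarify
    fix v w assume vw: "v \<in> X" "w \<in> X" and mod: "v mod (4 * a) = w mod (4 * a)"
      and nh: "(v, w) \<notin> ?h ` X" and ng: "(v, w) \<notin> ?g ` X" and nf: "(v, w) \<notin> ?f ` X"
      and ns: "(v, w) \<notin> prod.swap ` ?K"
    have ne: "v \<noteq> w" using nf vw by auto
    show "(v, w) \<in> ?K"
    proof (cases "v < w")
      case True
      then have "w - v \<noteq> 4 * a\<^sup>2" using ng vw by (auto simp: image_iff)
      moreover have "4 * a dvd w - v" using mod True by (metis less_imp_le mod_eq_dvd_iff_nat)
      ultimately show ?thesis using vw True by (simp add: collision_pairs_def)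
    next
      case False
      then have lt: "w < v" using ne by simp
      then have "v - w \<noteq> 4 * a\<^sup>2" using nh vw by (auto simp: image_iff)
      moreover have "4 * a dvd v - w" using mod lt by (metis less_imp_le mod_eq_dvd_iff_nat)
      ultimately have "(w, v) \<in> ?K" using vw lt by (simp add: collision_pairs_def)
      then show ?thesis using ns by (metis image_eqI swap_simp)
    qed
  qed
  then have "card ?P \<le> card (?K \<union> prod.swap ` ?K \<union> ?f ` X \<union> ?g ` X \<union> ?h ` X)"
    using X fK by (intro card_mono) auto
  also have "\<dots> \<le> card ?K + card (prod.swap ` ?K) + card (?f ` X) + card (?g ` X) + card (?h ` X)"
    by (meson add_mono card_Un_le order_refl order_trans)
  also have "\<dots> \<le> card ?K + card ?K + card X + card X + card X"
    using X fK by (intro add_mono card_image_le order_refl) auto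
  finally have P: "card ?P \<le> 2 * card ?K + 3 * card X" by simp
  have "(card X)\<^sup>2 \<le> 4 * a * card ?P"
    using card_congruent_pairs_ge[OF X, of "4 * a"] a by simp
  also have "\<dots> \<le> 4 * a * (2 * card ?K + 3 * card X)" using P by (rule mult_le_mono2)
  finally have "2 * (card X)\<^sup>2 \<le> 16 * a * card ?K + 24 * a * card X" by (simp add: algebra_simps)
  moreover have "24 * a * card X \<le> (card X)\<^sup>2" using big by (simp add: power2_eq_square)
  ultimately show ?thesis by linarith
qed

section \<open>Density of an additive complement\<close>

lemma card_complement_ge:
  fixes W :: "nat set"
  assumes cov: "\<And>n. n \<ge> n0 \<Longrightarrow> \<exists>w\<in>W. \<exists>s\<in>squares. n = w + s" and y: "2 * n0 \<le> y"
  shows "y \<le> 4 * (card {w\<in>W. w \<le> y})\<^sup>2"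
proof (cases "y = 0")
  case False
  let ?V = "{w\<in>W. w \<le> y}" and ?M = "{1..nat \<lfloor>sqrt y\<rfloor>}"
  \<comment> \<open>Every integer in this interval uses some \<open>w <= y\<close> and a root at
    most \<open>sqrt y\<close>. At least half of the integers up to \<open>y\<close> are covered, so
    \<open>card ?V\<close> is at least \<open>sqrt y / 2\<close>.\<close>
  have "{n0<..y} \<subseteq> (\<lambda>(w, m). w + m\<^sup>2) ` (?V \<times> ?M)"
  proof
    fix n assume n: "n \<in> {n0<..y}"
    then obtain w m where wm: "w \<in> W" "m \<ge> 1" "n = w + m\<^sup>2"
      using cov[of n] by (auto simp: squares_def)
    have "m\<^sup>2 \<le> y" using n wm by auto
    then have "real m \<le> sqrt y" by (metis of_nat_le_iff of_nat_power real_le_rsqrt)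
    then have "m \<in> ?M" using wm by (simp add: le_nat_floor)
    then show "n \<in> (\<lambda>(w, m). w + m\<^sup>2) ` (?V \<times> ?M)" using n wm by force
  qed
  then have "card {n0<..y} \<le> card (?V \<times> ?M)" by (intro surj_card_le) auto
  then have "y - n0 \<le> card ?V * nat \<lfloor>sqrt y\<rfloor>"
    by (simp add: card_cartesian_product)
  then have "real (y - n0) \<le> real (card ?V) * real (nat \<lfloor>sqrt y\<rfloor>)"
    by (simp only: of_nat_le_iff flip: of_nat_mult)
  also have "\<dots> \<le> real (card ?V) * sqrt y"
    by (intro mult_left_mono) (use of_nat_floor[of "sqrt y"] in auto)
  finally have "real y / 2 \<le> real (card ?V) * sqrt y" using y by linarith
  then have "(real y / 2)\<^sup>2 \<le> (real (card ?V) * sqrt y)\<^sup>2" by (intro power_mono) auto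
  then have "real y * real y \<le> real y * (4 * (real (card ?V))\<^sup>2)"
    by (simp add: power_mult_distrib power_divide) (simp add: power2_eq_square algebra_simps)
  then have "real y \<le> real (4 * (card ?V)\<^sup>2)" using False by simp
  then show ?thesis by (simp only: of_nat_le_iff)
qed simp

text \<open>Each \<open>w <= r^2\<close> together with each root \<open>1 <= m <= r\<close> is a
  separate representation of a value at most \<open>2 * r^2\<close>. This turns an upper bound for
  the sum of \<open>f2\<close> into one for the size of \<open>W\<close> up to
  \<open>r^2\<close>.\<close>

lemma card_mult_le_sum_f2:
  fixes W :: "nat set"
  shows "card {w\<in>W. w \<le> r\<^sup>2} * r \<le> (\<Sum>n = 1..2 * r\<^sup>2. f2 W n)"
proof -
  let ?V = "{w\<in>W. w \<le> r\<^sup>2}"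
  let ?R = "\<lambda>n. {w\<in>W. \<exists>m\<ge>1. n = w + m\<^sup>2}"
  let ?f = "\<lambda>(w, m). (w + m\<^sup>2, w)"
  have "inj_on ?f (?V \<times> {1..r})" by (auto simp: inj_on_def)
  moreover have "?f ` (?V \<times> {1..r}) \<subseteq> (SIGMA n:{1..2 * r\<^sup>2}. ?R n)"
  proof
    fix x assume "x \<in> ?f ` (?V \<times> {1..r})"
    then obtain w m where w: "w \<in> W" "w \<le> r\<^sup>2" and m: "1 \<le> m" "m \<le> r" and x: "x = (w + m\<^sup>2, w)"
      by auto
    have "m\<^sup>2 \<le> r\<^sup>2" "0 < m\<^sup>2" using m by (auto simp: power_mono)
    then have "1 \<le> w + m\<^sup>2" "w + m\<^sup>2 \<le> 2 * r\<^sup>2" using w by linarith+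
    then show "x \<in> (SIGMA n:{1..2 * r\<^sup>2}. ?R n)" using x w m by (auto simp del: One_nat_def)
  qed
  ultimately have "card (?V \<times> {1..r}) \<le> card (SIGMA n:{1..2 * r\<^sup>2}. ?R n)"
    using finite_reps by (intro card_inj_on_le) auto
  also have "\<dots> = (\<Sum>n = 1..2 * r\<^sup>2. f2 W n)"
    using finite_reps by (subst card_SigmaI) (auto simp: f2_eq_card)
  finally show ?thesis by (simp add: card_cartesian_product)
qed

text \<open>With w - v = 4 a c, this value equals v + (a + c)^2 = w + (a - c)^2; the
  condition w - v \<noteq> 4 a^2 in \<open>collision_pairs\<close> keeps the second square positive.\<close>
definition collision_value :: "nat \<Rightarrow> nat \<times> nat \<Rightarrow> nat" where
  "collision_value a = (\<lambda>(v, w). v + (a + (w - v) div (4 * a))\<^sup>2)"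

section \<open>Values of collisions and what determines a collision\<close>

lemma collision_pairsE:
  assumes "(v, w) \<in> collision_pairs a X" "a \<ge> 1"
  obtains c where "v \<in> X" "w \<in> X" "w = v + 4 * a * c" "c \<ge> 1" "c \<noteq> a" "collision_value a (v, w) = v + (a + c)\<^sup>2"
proof -
  have vw: "v \<in> X" "w \<in> X" "v < w" "4 * a dvd w - v" "w - v \<noteq> 4 * a\<^sup>2"
    using assms by (auto simp: collision_pairs_def)
  then obtain c where "w - v = 4 * a * c" by blast
  then have w: "w = v + 4 * a * c" using vw by simp
  show ?thesis
    by (rule that[of c]) (use vw w assms in \<open>auto simp: collision_value_def power2_eq_square Suc_le_eq intro: Nat.gr0I\<close>)
qed

lemma collision_value_reps:
  assumes "(v, w) \<in> collision_pairs a X" "a \<ge> 1"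
  shows "\<exists>m\<ge>1. collision_value a (v, w) = v + m\<^sup>2" "\<exists>m\<ge>1. collision_value a (v, w) = w + m\<^sup>2"
proof -
  obtain c where c: "w = v + 4 * a * c" "c \<ge> 1" "c \<noteq> a" "collision_value a (v, w) = v + (a + c)\<^sup>2"
    using assms by (rule collision_pairsE)
  show "\<exists>m\<ge>1. collision_value a (v, w) = v + m\<^sup>2" using c by (intro exI[of _ "a + c"]) auto
  show "\<exists>m\<ge>1. collision_value a (v, w) = w + m\<^sup>2"
  \<comment> \<open>The root is the absolute difference of \<open>a\<close> and \<open>c\<close>;
    truncated subtraction forces the two cases.\<close>
  proof (cases "c < a")
    case True
    then obtain d where "a = c + d" "d \<ge> 1" by (metis less_eqE less_imp_le Suc_leI add_gr_0 less_add_same_cancel1 One_nat_def)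
    then show ?thesis using c by (intro exI[of _ d]) (auto simp: power2_eq_square algebra_simps)
  next
    case False
    then obtain d where "c = a + d" "d \<ge> 1" using c by (metis less_eqE not_less_eq_eq add_0_right not_less One_nat_def le0 linorder_neqE_nat)
    then show ?thesis using c by (intro exI[of _ d]) (auto simp: power2_eq_square algebra_simps)
  qed
qed

text \<open>For fixed \<open>a\<close>, the value and \<open>v\<close> determine
  \<open>a + c\<close>, hence \<open>c\<close> and \<open>w\<close>. Collisions with a given
  \<open>a\<close> can thus be counted by incidences of a value and its smaller element.\<close>

lemma collision_value_inj_partner:
  assumes "(v, w) \<in> collision_pairs a X" "(v, w') \<in> collision_pairs a X" "a \<ge> 1"
    and "collision_value a (v, w) = collision_value a (v, w')"
  shows "w = w'"
proof -
  obtain c where c: "w = v + 4 * a * c" "collision_value a (v, w) = v + (a + c)\<^sup>2"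
    using assms(1,3) by (rule collision_pairsE)
  obtain c' where c': "w' = v + 4 * a * c'" "collision_value a (v, w') = v + (a + c')\<^sup>2"
    using assms(2,3) by (rule collision_pairsE)
  have "(a + c)\<^sup>2 = (a + c')\<^sup>2" using assms(4) c c' by simp
  then show ?thesis using c c' by simp
qed

text \<open>The value fixes \<open>a + c\<close> and the difference fixes \<open>a * c\<close>, so
  \<open>a\<close> is known up to exchange with \<open>c\<close>. The comparison of
  \<open>w - v\<close> with \<open>4 * a^2\<close> says whether \<open>c < a\<close> and settles the
  order. Two sets are allowed because in \<open>sum_excess_ge\<close> the cut-off depends on
  \<open>a\<close>.\<close>

lemma collision_value_inj_step:
  assumes "(v, w) \<in> collision_pairs a X" "(v, w) \<in> collision_pairs a' X'" "a \<ge> 1" "a' \<ge> 1"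
    and "collision_value a (v, w) = collision_value a' (v, w)"
    and "w - v < 4 * a\<^sup>2 \<longleftrightarrow> w - v < 4 * a'\<^sup>2"
  shows "a = a'"
proof -
  obtain c where c: "w = v + 4 * a * c" "c \<noteq> a" "collision_value a (v, w) = v + (a + c)\<^sup>2"
    using assms(1,3) by (rule collision_pairsE)
  obtain c' where c': "w = v + 4 * a' * c'" "c' \<noteq> a'" "collision_value a' (v, w) = v + (a' + c')\<^sup>2"
    using assms(2,4) by (rule collision_pairsE)
  have "(a + c)\<^sup>2 = (a' + c')\<^sup>2" using assms(5) unfolding c(3) c'(3) by simp
  then have s: "a + c = a' + c'" by simp
  have p: "a * c = a' * c'" using c c' by simp
  have "w - v < 4 * a\<^sup>2 \<longleftrightarrow> c < a" using c(1) assms(3) by (simp add: power2_eq_square)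
  moreover have "w - v < 4 * a'\<^sup>2 \<longleftrightarrow> c' < a'" using c'(1) assms(4) by (simp add: power2_eq_square)
  ultimately have iff: "c < a \<longleftrightarrow> c' < a'" using assms(6) by simp
  \<comment> \<open>Vieta: equal sums and products make \<open>a\<close> a root of the quadratic
    polynomial with roots \<open>a'\<close> and \<open>c'\<close>.\<close>
  have "(int a - int a') * (int a - int c') = 0"
  proof -
    have "(int a - int a') * (int a - int c') = int a * (int a - (int a' + int c')) + int a' * int c'"
      by (simp add: algebra_simps)
    also have "int a - (int a' + int c') = - int c" using s by linarith
    also have "int a' * int c' = int a * int c" using p by (metis of_nat_mult)
    finally show ?thesis by simp
  qed
  then consider "a = a'" | "a = c'" by auto
  then show ?thesis
  proof cases
    case 2
    then show ?thesis using s iff c c' by auto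
  qed
qed

text \<open>The collisions number at least s^2 t^2 / 16, and those at values with at least B representations
  at most 12 s t^2, which is at most half of the former as s \<ge> 384.\<close>
lemma sum_excess_ge:
  fixes W :: "nat set" and s t N n0 :: nat and D :: real
  assumes cov: "\<And>n. n \<ge> n0 \<Longrightarrow> \<exists>w\<in>W. \<exists>q\<in>squares. n = w + q"
    and s: "s \<ge> 384" and t: "t \<ge> 1" and n0: "n0 \<le> 2 * s\<^sup>2 * t" and N: "2 * s ^ 4 * t\<^sup>2 \<le> N"
    and D: "D \<ge> 1" and div: "\<And>d. 0 < d \<Longrightarrow> d \<le> N \<Longrightarrow> real (card {u. u dvd d}) \<le> D"
    and small: "(\<Sum>n = 1..N. f2 W n - 1) \<le> (2 * s * t)\<^sup>2"
  shows "real (s\<^sup>2 * t\<^sup>2) \<le> 128 * sqrt (12 * s * t * D) * real (\<Sum>n = 1..N. f2 W n - 1)"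
proof -
  define E where "E = (\<Sum>n = 1..N. f2 W n - 1)"
  \<comment> \<open>This is \<open>4 * t * L\<close>, the largest of the cut-offs
    \<open>4 * a * L\<close> used in \<open>Q\<close>; being a square, it suits
    \<open>card_mult_le_sum_f2\<close>.\<close>
  define h where "h = (2 * s * t)\<^sup>2"
  define L where "L = s\<^sup>2 * t"
  define V where "V = {w\<in>W. w \<le> h}"
  define R where "R n = {w\<in>V. \<exists>m\<ge>1. n = w + m\<^sup>2}" for n
  \<comment> \<open>The square of \<open>B\<close> is \<open>2 * D\<close> times the bound
    \<open>6 * s * t\<close> for \<open>card V\<close>, which is what the absorption in
    \<open>e_le\<close> requires.\<close>
  define B where "B = sqrt (12 * s * t * D)"
  define S where "S = {n\<in>{1..N}. B \<le> real (card (R n))}"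
  define T where "T = {n\<in>{1..N}. 2 \<le> card (R n) \<and> real (card (R n)) < B}"
  \<comment> \<open>The cut-off grows with \<open>a\<close>: every \<open>a\<close> then contributes
    at least \<open>L / 16\<close> pairs, while the cofactor \<open>c\<close> stays at most
    \<open>L\<close>, which keeps the values up to \<open>N\<close>.\<close>
  define Q where "Q = (SIGMA a:{1..t}. collision_pairs a {w\<in>W. w \<le> 4 * a * L})"
  define val where "val = (\<lambda>(a, p). collision_value a p)"
  have st: "s > 0" "t > 0" using s t by auto
  have finV: "finite V" unfolding V_def by (rule finite_subset[of _ "{..h}"]) auto
  have finR: "finite (R n)" for n using finV by (simp add: R_def)
  have finS: "finite S" and finT: "finite T" by (simp_all add: S_def T_def)
  have R_le: "card (R n) \<le> f2 W n" for n
    unfolding f2_eq_card by (rule card_mono[OF finite_reps]) (auto simp: R_def V_def)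
  have B2: "B\<^sup>2 = 12 * s * t * D" using D by (simp add: B_def)
  have Bpos: "B > 0" using D st by (simp add: B_def)
  have s4: "s ^ 4 = s\<^sup>2 * s\<^sup>2" by (simp add: power_add[symmetric])
  have s2: "s\<^sup>2 \<ge> 384 * 384" using power_mono[OF s, of 2] by simp
  have s2s: "384 * 384 * s\<^sup>2 \<le> s\<^sup>2 * s\<^sup>2" using s2 by (intro mult_right_mono) auto
  have N': "2 * (s\<^sup>2 * s\<^sup>2) * t\<^sup>2 \<le> N" using N unfolding s4 .

  \<comment> \<open>Elements of \<open>V\<close> combined with the first \<open>2 * s * t\<close>
    squares give representations of values up to \<open>2 * h\<close>. Their number is at most
    \<open>2 * h\<close> plus the excess, and \<open>small\<close> bounds the excess by
    \<open>h\<close>.\<close>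
  have cardV: "card V \<le> 6 * s * t"
  proof -
    have "8 * s\<^sup>2 * t\<^sup>2 \<le> 2 * (s\<^sup>2 * s\<^sup>2) * t\<^sup>2"
      using s2s by (intro mult_right_mono) auto
    also note N'
    finally have hN: "2 * h \<le> N" by (simp add: h_def power_mult_distrib)
    have "card V * (2 * s * t) \<le> (\<Sum>n = 1..2 * h. f2 W n)"
      using card_mult_le_sum_f2[of W "2 * s * t"] by (simp add: V_def h_def)
    also have "\<dots> \<le> (\<Sum>n = 1..2 * h. (f2 W n - 1) + 1)" by (intro sum_mono) auto
    also have "\<dots> = (\<Sum>n = 1..2 * h. f2 W n - 1) + 2 * h" by (subst sum.distrib) simp
    also have "(\<Sum>n = 1..2 * h. f2 W n - 1) \<le> E"
      unfolding E_def using hN by (intro sum_mono2) auto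
    finally have "card V * (2 * s * t) \<le> 3 * h" using small by (simp add: E_def h_def)
    also have "3 * h = 6 * s * t * (2 * s * t)" by (simp add: h_def power2_eq_square)
    finally show ?thesis using st by simp
  qed

  define e where "e = (\<Sum>n\<in>S. card (R n))"
  have e_le: "real e \<le> 12 * s * t"
  proof (cases "e = 0")
    case False
    have codeg: "real (card (R n \<inter> R n')) \<le> D" if "n \<in> S" "n' \<in> S" "n < n'" for n n'
    proof -
      have "R n \<inter> R n' \<subseteq> {w. (\<exists>m. n = w + m\<^sup>2) \<and> (\<exists>m. n' = w + m\<^sup>2)}"
        by (auto simp: R_def)
      moreover have "finite {w. (\<exists>m. n = w + m\<^sup>2) \<and> (\<exists>m. n' = w + m\<^sup>2)}"
        by (rule finite_subset[of _ "{..n}"]) auto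
      ultimately have "card (R n \<inter> R n') \<le> card {d. d dvd n' - n}"
        using card_common_reps_le[OF that(3)] card_mono order_trans by blast
      moreover have "real (card {d. d dvd n' - n}) \<le> D"
        using that by (intro div) (auto simp: S_def)
      ultimately show ?thesis by linarith
    qed
    have "(real e)\<^sup>2 \<le> real (card V) * (real e + D * (real (card S))\<^sup>2)"
      unfolding e_def
    proof (rule card_incidences_squared_le[OF finS finV])
      fix n n' assume "n \<in> S" "n' \<in> S" "n \<noteq> n'"
      then show "real (card (R n \<inter> R n')) \<le> D"
        using codeg[of n n'] codeg[of n' n] by (cases "n < n'") (auto simp: Int_commute)
    qed (use D in \<open>auto simp: R_def\<close>)
    also have "\<dots> \<le> (6 * s * t) * (real e + D * (real (card S))\<^sup>2)"
      by (rule mult_right_mono[OF of_nat_mono[OF cardV]]) (use D in simp)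
    finally have 1: "2 * (real e)\<^sup>2 \<le> 12 * s * t * real e + B\<^sup>2 * (real (card S))\<^sup>2"
      by (simp add: B2 algebra_simps)
    \<comment> \<open>Each \<open>n\<close> in \<open>S\<close> carries at least \<open>B\<close>
      incidences, so the last term of \<open>1\<close> is at most the square of \<open>e\<close> and
      is absorbed on the left.\<close>
    have "B * real (card S) = (\<Sum>n\<in>S. B)" by simp
    also have "\<dots> \<le> (\<Sum>n\<in>S. real (card (R n)))" by (intro sum_mono) (simp add: S_def)
    finally have "B * real (card S) \<le> real e" by (simp add: e_def)
    then have "(B * real (card S))\<^sup>2 \<le> (real e)\<^sup>2" using Bpos by (intro power_mono) auto
    then have "(real e)\<^sup>2 \<le> 12 * s * t * real e"
      using 1 unfolding power_mult_distrib by linarith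
    then have "real e * real e \<le> 12 * s * t * real e" by (simp add: power2_eq_square)
    then show ?thesis using False by simp
  qed simp

  have Qval: "val x \<in> {1..N}" "v \<in> R (val x)" "w \<in> R (val x)" "v \<noteq> w"
    if "x \<in> Q" "x = (a, v, w)" for x a v w
  proof -
    let ?X = "{w\<in>W. w \<le> 4 * a * L}"
    have a: "1 \<le> a" "a \<le> t" and vw: "(v, w) \<in> collision_pairs a ?X" using that by (auto simp: Q_def)
    have valx: "val x = collision_value a (v, w)" using that by (simp add: val_def)
    obtain c where c: "v \<in> ?X" "w \<in> ?X" "w = v + 4 * a * c" "c \<ge> 1"
      and eq: "collision_value a (v, w) = v + (a + c)\<^sup>2"
      using vw a(1) by (rule collision_pairsE)
    have aL: "4 * a * L \<le> h"
      using a by (simp add: h_def L_def power_mult_distrib) (simp add: power2_eq_square)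
    show "v \<noteq> w" using c a by simp
    show "v \<in> R (val x)" "w \<in> R (val x)"
      using collision_value_reps[OF vw a(1)] c aL by (auto simp: R_def V_def valx)
    have "w \<le> 4 * a * L" using c by simp
    then have "4 * a * c \<le> 4 * a * L" using c(3) by linarith
    then have "c \<le> L" using a by simp
    then have "(a + c)\<^sup>2 \<le> (t + L)\<^sup>2" using a by (intro power_mono) auto
    moreover have "v \<le> h" using c(1) aL by simp
    ultimately have "v + (a + c)\<^sup>2 \<le> h + (t + L)\<^sup>2" by linarith
    also have "\<dots> = (6 * s\<^sup>2 + s\<^sup>2 * s\<^sup>2 + 1) * t\<^sup>2"
      by (simp add: h_def L_def power_mult_distrib power2_eq_square algebra_simps)
    also have "\<dots> \<le> (2 * (s\<^sup>2 * s\<^sup>2)) * t\<^sup>2"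
      using s2s s2 by (intro mult_right_mono) linarith+
    also have "\<dots> \<le> N" by (rule N')
    finally have "val x \<le> N" by (simp add: valx eq)
    moreover have "0 < (a + c)\<^sup>2" using a by simp
    then have "1 \<le> val x" unfolding valx eq by linarith
    ultimately show "val x \<in> {1..N}" by simp
  qed
  have finX: "finite {w\<in>W. w \<le> y}" for y by (rule finite_subset[of _ "{..y}"]) auto
  have finQ: "finite Q" unfolding Q_def using finX finite_collision_pairs by blast

  have Q_ge: "s\<^sup>2 * t\<^sup>2 \<le> 16 * card Q"
  proof -
    have "L \<le> 16 * card (collision_pairs a {w\<in>W. w \<le> 4 * a * L})" if a: "a \<in> {1..t}" for a
    proof -
      let ?X = "{w\<in>W. w \<le> 4 * a * L}"
      have "2 * n0 \<le> 4 * L" using n0 unfolding L_def by linarith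
      also have "\<dots> \<le> 4 * a * L" using a by simp
      finally have "2 * n0 \<le> 4 * a * L" .
      then have "4 * a * L \<le> 4 * (card ?X)\<^sup>2" using cov by (intro card_complement_ge) auto
      then have k: "a * L \<le> (card ?X)\<^sup>2" by simp
      \<comment> \<open>The size condition of \<open>card_collision_pairs_ge\<close> follows from
        \<open>s^2 >= 576\<close> and \<open>a <= t\<close>.\<close>
      have "(24 * a)\<^sup>2 = 576 * a * a" by (simp add: power2_eq_square)
      also have "\<dots> \<le> s\<^sup>2 * a * t" using a s2 by (intro mult_mono) auto
      also have "\<dots> \<le> (card ?X)\<^sup>2" using k by (simp add: L_def mult_ac)
      finally have "24 * a \<le> card ?X" by (rule power2_le_imp_le) simp
      then have "(card ?X)\<^sup>2 \<le> 16 * a * card (collision_pairs a ?X)"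
        using a finX by (intro card_collision_pairs_ge) auto
      with k have "a * L \<le> a * (16 * card (collision_pairs a ?X))" by linarith
      then show ?thesis using a by simp
    qed
    then have "(\<Sum>a\<in>{1..t}. L) \<le> (\<Sum>a\<in>{1..t}. 16 * card (collision_pairs a {w\<in>W. w \<le> 4 * a * L}))"
      by (rule sum_mono)
    also have "\<dots> = 16 * card Q"
      unfolding Q_def using finX finite_collision_pairs by (subst card_SigmaI) (auto simp: sum_distrib_left)
    finally show ?thesis by (simp add: L_def power2_eq_square mult_ac)
  qed

  \<comment> \<open>The triple of \<open>a\<close>, value and \<open>v\<close> recovers the
    collision. The factor \<open>t\<close> for the choice of \<open>a\<close> is affordable since
    \<open>e\<close> is only of order \<open>s * t\<close>.\<close>
  have Q_big: "card {x\<in>Q. val x \<in> S} \<le> t * e"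
  proof -
    let ?f = "\<lambda>(a, v, w). (a, collision_value a (v, w), v)"
    have "inj_on ?f {x\<in>Q. val x \<in> S}"
      by (auto simp: inj_on_def Q_def intro: collision_value_inj_partner)
    moreover have "?f ` {x\<in>Q. val x \<in> S} \<subseteq> {1..t} \<times> (SIGMA n:S. R n)"
    proof
      fix y assume "y \<in> ?f ` {x\<in>Q. val x \<in> S}"
      then obtain a v w where x: "(a, v, w) \<in> Q" "val (a, v, w) \<in> S" and y: "y = ?f (a, v, w)"
        by auto
      then show "y \<in> {1..t} \<times> (SIGMA n:S. R n)"
        using Qval(2)[OF x(1) refl] by (auto simp: val_def Q_def)
    qed
    ultimately have "card {x\<in>Q. val x \<in> S} \<le> card ({1..t} \<times> (SIGMA n:S. R n))"
      using finS finR by (intro card_inj_on_le) auto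
    also have "\<dots> = t * e" using finS finR by (simp add: card_cartesian_product e_def)
    finally show ?thesis .
  qed

  \<comment> \<open>Here a factor \<open>t\<close> is avoided: a value and a pair leave at most two
    choices of \<open>a\<close>, told apart by one Boolean.\<close>
  have Q_small: "card {x\<in>Q. val x \<in> T} \<le> (\<Sum>n\<in>T. 2 * (card (R n))\<^sup>2)"
  proof -
    let ?f = "\<lambda>(a, v, w). (collision_value a (v, w), (v, w), w - v < 4 * a\<^sup>2)"
    have "inj_on ?f {x\<in>Q. val x \<in> T}"
      by (auto simp: inj_on_def Q_def intro: collision_value_inj_step)
    moreover have "?f ` {x\<in>Q. val x \<in> T} \<subseteq> (SIGMA n:T. (R n \<times> R n) \<times> UNIV)"
    proof
      fix y assume "y \<in> ?f ` {x\<in>Q. val x \<in> T}"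
      then obtain a v w where x: "(a, v, w) \<in> Q" "val (a, v, w) \<in> T" and y: "y = ?f (a, v, w)"
        by auto
      then show "y \<in> (SIGMA n:T. (R n \<times> R n) \<times> UNIV)"
        using Qval(2,3)[OF x(1) refl] by (auto simp: val_def)
    qed
    ultimately have "card {x\<in>Q. val x \<in> T} \<le> card (SIGMA n:T. (R n \<times> R n) \<times> (UNIV :: bool set))"
      using finT finR by (intro card_inj_on_le) auto
    also have "\<dots> = (\<Sum>n\<in>T. 2 * (card (R n))\<^sup>2)"
      using finT finR by (subst card_SigmaI) (auto simp: card_cartesian_product power2_eq_square mult_ac)
    finally show ?thesis .
  qed

  have "Q \<subseteq> {x\<in>Q. val x \<in> S} \<union> {x\<in>Q. val x \<in> T}"
  proof
    fix x assume x: "x \<in> Q"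
    obtain a v w where avw: "x = (a, v, w)" by (cases x)
    note q = Qval[OF x avw]
    have "card {v, w} \<le> card (R (val x))" using q finR by (intro card_mono) auto
    then have "2 \<le> card (R (val x))" using q by simp
    then show "x \<in> {x\<in>Q. val x \<in> S} \<union> {x\<in>Q. val x \<in> T}"
      using x q(1) by (auto simp: S_def T_def not_le)
  qed
  then have "card Q \<le> card ({x\<in>Q. val x \<in> S} \<union> {x\<in>Q. val x \<in> T})"
    using finQ by (intro card_mono) auto
  also have "\<dots> \<le> card {x\<in>Q. val x \<in> S} + card {x\<in>Q. val x \<in> T}" by (rule card_Un_le)
  finally have "card Q \<le> t * e + (\<Sum>n\<in>T. 2 * (card (R n))\<^sup>2)" using Q_big Q_small by linarith
  then have "real (card Q) \<le> real (t * e) + real (\<Sum>n\<in>T. 2 * (card (R n))\<^sup>2)"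
    by (simp only: of_nat_le_iff flip: of_nat_add)
  moreover have "real (\<Sum>n\<in>T. 2 * (card (R n))\<^sup>2) \<le> 4 * B * real E"
  proof -
    have "real (\<Sum>n\<in>T. 2 * (card (R n))\<^sup>2) = (\<Sum>n\<in>T. 2 * (real (card (R n)) * real (card (R n))))"
      by (simp add: power2_eq_square)
    also have "\<dots> \<le> (\<Sum>n\<in>T. 2 * (B * (2 * real (f2 W n - 1))))"
    proof (intro sum_mono mult_left_mono mult_mono)
      fix n assume n: "n \<in> T"
      then show "real (card (R n)) \<le> B" by (simp add: T_def)
      \<comment> \<open>Since \<open>f2 W n >= card (R n) >= 2\<close>, subtracting 1 loses at most
        half.\<close>
      have "card (R n) \<le> 2 * (f2 W n - 1)" using n R_le[of n] by (auto simp: T_def)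
      then show "real (card (R n)) \<le> 2 * real (f2 W n - 1)" by linarith
    qed (use Bpos in auto)
    also have "\<dots> = 4 * B * real (\<Sum>n\<in>T. f2 W n - 1)" by (simp add: sum_distrib_left mult_ac)
    also have "\<dots> \<le> 4 * B * real E"
      unfolding E_def using Bpos
      by (intro mult_left_mono of_nat_mono sum_mono2) (auto simp: T_def)
    finally show ?thesis .
  qed
  moreover have "real (t * e) \<le> 12 * s * t\<^sup>2"
    using mult_left_mono[OF e_le, of "real t"] by (simp add: power2_eq_square mult_ac)
  moreover have "real (s\<^sup>2 * t\<^sup>2) \<le> 16 * real (card Q)" using Q_ge by linarith
  \<comment> \<open>Sixteen times the share \<open>12 * s * t^2\<close> of \<open>S\<close> is at
    most half of \<open>s^2 * t^2\<close>; doubling the remaining \<open>64 * B * E\<close> gives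
    the factor 128.\<close>
  moreover have "real (384 * s * t\<^sup>2) \<le> real (s\<^sup>2 * t\<^sup>2)"
    using s by (intro of_nat_mono mult_right_mono) (simp_all add: power2_eq_square)
  ultimately have "real (s\<^sup>2 * t\<^sup>2) \<le> 128 * B * real E" by simp
  then show ?thesis by (simp only: B_def E_def)
qed

subsection \<open>The lower bound for the excess\<close>

text \<open>Take \<open>s = 384\<close> in \<open>sum_excess_ge\<close> and \<open>t\<close> of
  order \<open>sqrt N\<close>; dividing \<open>t^2\<close> by \<open>sqrt t\<close> leaves
  \<open>t\<close> to the power 3/2, of order \<open>N powr (3 / 4)\<close>. The constant is uniform
  in \<open>D\<close>, so that a divisor bound depending on \<open>N\<close> can be inserted
  afterwards.\<close>

lemma sum_excess_lower_bound:
  fixes W :: "nat set"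
  assumes cov: "\<And>n. n \<ge> n0 \<Longrightarrow> \<exists>w\<in>W. \<exists>q\<in>squares. n = w + q"
  obtains c :: real where "c > 0"
    "\<forall>\<^sub>F N in sequentially. \<forall>D\<ge>1.
       (\<forall>d. 0 < d \<longrightarrow> d \<le> N \<longrightarrow> real (card {u. u dvd d}) \<le> D) \<longrightarrow>
       c * real N powr (3 / 4) \<le> sqrt D * real (\<Sum>n = 1..N. f2 W n - 1)"
proof
  define k :: real where "k = 2 * 384 ^ 4"
  \<comment> \<open>From \<open>x^2 = N / k\<close> and \<open>t >= x / 2\<close>, the square of
    \<open>t\<close> is at least \<open>N / (4 * k)\<close>.\<close>
  define c where "c = (1 / (4 * k)) powr (3 / 4)"
  show "c > 0" by (simp add: c_def k_def)
  \<comment> \<open>This threshold gives \<open>x >= n0 + 1\<close>, so that rounding down still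
    leaves \<open>t >= 1\<close> and \<open>t >= n0\<close>.\<close>
  have "\<forall>\<^sub>F N :: nat in sequentially. real N \<ge> k * (real n0 + 1)\<^sup>2"
    using filterlim_real_sequentially by (rule filterlim_at_top[THEN iffD1, rule_format])
  then show "\<forall>\<^sub>F N in sequentially. \<forall>D\<ge>1.
       (\<forall>d. 0 < d \<longrightarrow> d \<le> N \<longrightarrow> real (card {u. u dvd d}) \<le> D) \<longrightarrow>
       c * real N powr (3 / 4) \<le> sqrt D * real (\<Sum>n = 1..N. f2 W n - 1)"
  proof (eventually_elim, intro allI impI)
    fix N D assume N: "real N \<ge> k * (real n0 + 1)\<^sup>2" and D: "(1::real) \<le> D"
      and div: "\<forall>d. 0 < d \<longrightarrow> d \<le> N \<longrightarrow> real (card {u. u dvd d}) \<le> D"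
    define x where "x = sqrt (real N / k)"
    define t where "t = nat \<lfloor>x\<rfloor>"
    define X where "X = (\<Sum>n = 1..N. f2 W n - 1)"
    have k: "k > 0" by (simp add: k_def)
    have x: "x \<ge> real n0 + 1"
      unfolding x_def using N k by (intro real_le_rsqrt) (simp add: field_simps)
    have t: "real t \<le> x" "x / 2 \<le> real t" "real n0 \<le> real t" "1 \<le> real t"
    proof -
      have fl: "real t = of_int \<lfloor>x\<rfloor>" using x by (simp add: t_def)
      show "real t \<le> x" unfolding fl by simp
      have lt: "x < real t + 1" unfolding fl by linarith
      show "real n0 \<le> real t" using lt x by linarith
      have "0 < real t" using lt x by linarith
      then show "1 \<le> real t" by simp
      then show "x / 2 \<le> real t" using lt by linarith
    qed
    have main: "real t * sqrt (real t) \<le> sqrt D * real X"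
    \<comment> \<open>The case split supplies the hypothesis \<open>small\<close> of
      \<open>sum_excess_ge\<close>; a larger excess already exceeds \<open>t^2\<close>.\<close>
    proof (cases "X \<le> (2 * 384 * t)\<^sup>2")
      case True
      have "(real t)\<^sup>2 \<le> x\<^sup>2" using t by (intro power_mono) auto
      also have "x\<^sup>2 = real N / k" using k by (simp add: x_def)
      finally have "real (2 * 384 ^ 4 * t\<^sup>2) \<le> real N" using k by (simp add: field_simps k_def)
      then have tN: "2 * 384 ^ 4 * t\<^sup>2 \<le> N" by (simp only: of_nat_le_iff)
      have "real (384\<^sup>2 * t\<^sup>2) \<le> 128 * sqrt (12 * 384 * t * D) * real X"
        unfolding X_def
        using True tN t D div by (intro sum_excess_ge[OF cov]) (auto simp: X_def)
      also have "sqrt (12 * 384 * t * D) = sqrt 4608 * sqrt t * sqrt D"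
        by (simp flip: real_sqrt_mult)
      \<comment> \<open>Here \<open>68^2 = 4624\<close> exceeds
        \<open>4608 = 12 * 384\<close>.\<close>
      also have "128 * (sqrt 4608 * sqrt t * sqrt D) * real X \<le> 128 * (68 * sqrt t * sqrt D) * real X"
        using D by (intro mult_mono mult_nonneg_nonneg real_le_lsqrt) auto
      finally have "(real t)\<^sup>2 * 147456 \<le> 8704 * (sqrt t * (sqrt D * real X))"
        by (simp add: mult_ac)
      moreover have "0 \<le> sqrt t * (sqrt D * real X)" using D by simp
      ultimately have "(real t)\<^sup>2 \<le> sqrt t * (sqrt D * real X)" by linarith
      moreover have "(real t)\<^sup>2 = sqrt t * (t * sqrt t)"
        by (simp add: power2_eq_square)
      ultimately show ?thesis using t by simp
    next
      case False
      have "real t * sqrt t \<le> real t * real t"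
        using t by (intro mult_left_mono real_le_lsqrt) (auto simp: power2_eq_square mult_left_mono)
      also have "\<dots> \<le> real ((2 * 384 * t)\<^sup>2)" by (simp add: power2_eq_square)
      also have "\<dots> \<le> real X" using False by (intro of_nat_mono) simp
      also have "\<dots> \<le> sqrt D * real X" using D mult_right_mono[of 1 "sqrt D" "real X"] by simp
      finally show ?thesis .
    qed
    have "c * real N powr (3 / 4) = (real N / (4 * k)) powr (3 / 4)"
      using k by (simp add: c_def powr_mult[symmetric])
    also have "real N / (4 * k) = (x / 2)\<^sup>2" using k by (simp add: x_def power_divide)
    also have "(x / 2)\<^sup>2 powr (3 / 4) = (x / 2) powr (3 / 2)"
      using x by (simp add: powr_powr flip: powr_numeral)
    also have "\<dots> \<le> real t powr (3 / 2)" using t x by (intro powr_mono2) auto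
    also have "\<dots> = real t powr 1 * real t powr (1 / 2)" by (subst powr_add[symmetric]) simp
    also have "\<dots> = real t * sqrt (real t)" by (simp add: powr_half_sqrt)
    finally show "c * real N powr (3 / 4) \<le> sqrt D * real (\<Sum>n = 1..N. f2 W n - 1)"
      using main by (simp only: X_def)
  qed
qed

text \<open>Truncated subtraction differs from the true one only where \<open>f2 W n = 0\<close>,
  and there by 1; this can occur only for \<open>n < n0\<close>.\<close>

lemma sum_excess_le:
  fixes W :: "nat set"
  assumes cov: "\<And>n. n \<ge> n0 \<Longrightarrow> \<exists>w\<in>W. \<exists>q\<in>squares. n = w + q"
  shows "real (\<Sum>n = 1..N. f2 W n - 1) \<le> (\<Sum>n = 1..N. real (f2 W n)) - real N + real n0"
proof -
  have "f2 W n - 1 + 1 \<le> f2 W n + (if n < n0 then 1 else 0)" for n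
  proof (cases "n < n0")
    case False
    then obtain w m where "w \<in> W" "m \<ge> 1" "n = w + m\<^sup>2" using cov[of n] by (auto simp: squares_def)
    then have "w \<in> {w\<in>W. \<exists>m\<ge>1. n = w + m\<^sup>2}" by auto
    then have "0 < f2 W n" unfolding f2_eq_card using finite_reps[of W n] by (auto simp: card_gt_0_iff)
    then show ?thesis by simp
  qed simp
  then have "(\<Sum>n = 1..N. f2 W n - 1 + 1) \<le> (\<Sum>n = 1..N. f2 W n + (if n < n0 then 1 else 0))"
    by (rule sum_mono)
  also have "\<dots> = (\<Sum>n = 1..N. f2 W n) + (\<Sum>n = 1..N. if n < n0 then 1 else 0)"
    by (rule sum.distrib)
  also have "(\<Sum>n = 1..N. if n < n0 then 1 else 0) = card ({1..N} \<inter> {n. n < n0})"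
    by (simp add: sum.If_cases)
  also have "\<dots> \<le> card {..<n0}" by (intro card_mono) auto
  also have "(\<Sum>n = 1..N. f2 W n - 1 + 1) = (\<Sum>n = 1..N. f2 W n - 1) + N"
    by (subst sum.distrib) simp
  finally have "real ((\<Sum>n = 1..N. f2 W n - 1) + N) \<le> real ((\<Sum>n = 1..N. f2 W n) + n0)"
    by (intro of_nat_mono) simp
  then show ?thesis by simp
qed

theorem corollary2:
  fixes W :: "nat set"
  assumes "additive_complement_of_squares W"
  shows "(\<exists>\<delta> :: nat \<Rightarrow> real. \<delta> \<longlonglongrightarrow> 0 \<and>
            (\<forall>\<^sub>F N :: nat in sequentially.
               (\<Sum>n = 1..N. real (f2 W n)) - real N
                 \<ge> real N powr (3 / 4) *
                    exp (- (ln 2 / 2 + \<delta> N) * (ln (real N) / ln (ln (real N))))))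
       \<and> (\<forall>\<epsilon> > (0 :: real). \<exists>C > (0 :: real).
            \<forall>\<^sub>F N :: nat in sequentially.
               (\<Sum>n = 1..N. real (f2 W n)) - real N
                 \<ge> C * real N powr (3 / 4 - \<epsilon>))"
proof -
  define E where "E N = (\<Sum>n = 1..N. real (f2 W n)) - real N" for N
  define g where "g N = divisor_exponent (real N)" for N :: nat
  obtain n0 where cov: "\<And>n. n \<ge> n0 \<Longrightarrow> \<exists>w\<in>W. \<exists>q\<in>squares. n = w + q"
    using assms unfolding additive_complement_of_squares_def eventually_sequentially by blast
  obtain c where c: "c > 0" and lower: "\<forall>\<^sub>F N in sequentially. \<forall>D\<ge>1.
       (\<forall>d. 0 < d \<longrightarrow> d \<le> N \<longrightarrow> real (card {u. u dvd d}) \<le> D) \<longrightarrow>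
       c * real N powr (3 / 4) \<le> sqrt D * real (\<Sum>n = 1..N. f2 W n - 1)"
    using sum_excess_lower_bound[of n0 W] cov by blast
  note seq = eventually_compose_filterlim[OF _ filterlim_real_sequentially]
  \<comment> \<open>Beyond this point \<open>n0\<close> is at most half of the lower bound, which is
    why \<open>main\<close> carries \<open>c / 2\<close>.\<close>
  have "\<forall>\<^sub>F N in sequentially. real N powr (3 / 4) * exp (- g N / 2) \<ge> 2 * real n0 / c"
    unfolding g_def using divisor_exponent_at_top
    by (intro seq) (simp add: filterlim_at_top)
  moreover have "\<forall>\<^sub>F N in sequentially. g N \<ge> 0"
    unfolding g_def by (intro seq eventually_divisor_exponent_nonneg)
  ultimately have main: "\<forall>\<^sub>F N in sequentially. c / 2 * real N powr (3 / 4) * exp (- g N / 2) \<le> E N"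
    using lower eventually_card_divisors_le
  proof eventually_elim
    case (elim N)
    let ?X = "real (\<Sum>n = 1..N. f2 W n - 1)" and ?M = "real N powr (3 / 4) * exp (- g N / 2)"
    have "c * real N powr (3 / 4) \<le> sqrt (exp (g N)) * ?X"
      using elim by (simp add: g_def)
    also have "sqrt (exp (g N)) = exp (g N / 2)"
      by (rule real_sqrt_unique) (simp_all add: exp_double[symmetric])
    finally have "c * real N powr (3 / 4) * exp (- g N / 2) \<le> exp (g N / 2) * ?X * exp (- g N / 2)"
      by (intro mult_right_mono) auto
    also have "\<dots> = ?X" by (simp add: mult.assoc exp_minus field_simps)
    also have "\<dots> \<le> E N + real n0" unfolding E_def by (rule sum_excess_le[OF cov])
    finally have "c * ?M \<le> E N + real n0" by (simp add: mult.assoc)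
    moreover have "2 * real n0 \<le> c * ?M" using elim(1) c by (simp add: field_simps)
    ultimately have "c / 2 * ?M \<le> E N" by simp
    then show ?case by (simp add: mult.assoc)
  qed

  \<comment> \<open>Obtained by solving \<open>(ln 2 / 2 + \<delta> N) * (ln N / ln (ln N)) = g N /
    2 - ln (c / 2)\<close>, so that the constant \<open>c / 2\<close> of \<open>main\<close> is
    absorbed into the exponent.\<close>
  define \<delta> where
    "\<delta> N = (g N / 2 - ln (c / 2)) * (ln (ln (real N)) / ln (real N)) - ln 2 / 2" for N :: nat
  have "(\<lambda>N. g N / 2 * (ln (ln (real N)) / ln (real N))) \<longlonglongrightarrow> ln 2 / 2"
    unfolding g_def
    by (rule filterlim_compose[OF divisor_exponent_asymp filterlim_real_sequentially])
  moreover have "(\<lambda>N. ln (ln (real N)) / ln (real N)) \<longlonglongrightarrow> 0" by real_asymp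
  ultimately have "(\<lambda>N. g N / 2 * (ln (ln (real N)) / ln (real N))
      - ln (c / 2) * (ln (ln (real N)) / ln (real N)) - ln 2 / 2) \<longlonglongrightarrow> ln 2 / 2 - ln (c / 2) * 0 - ln 2 / 2"
    by (intro tendsto_intros)
  then have \<delta>: "\<delta> \<longlonglongrightarrow> 0" unfolding \<delta>_def by (simp add: algebra_simps)

  have "\<forall>\<^sub>F N :: nat in sequentially. ln (ln (real N)) > 0" by real_asymp
  moreover have "\<forall>\<^sub>F N :: nat in sequentially. ln (real N) > 0" by real_asymp
  ultimately have 1: "\<forall>\<^sub>F N in sequentially. E N \<ge> real N powr (3 / 4) *
      exp (- (ln 2 / 2 + \<delta> N) * (ln (real N) / ln (ln (real N))))"
    using main
  proof eventually_elim
    case (elim N)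
    have "(ln 2 / 2 + \<delta> N) * (ln (real N) / ln (ln (real N))) = g N / 2 - ln (c / 2)"
      using elim(1,2) by (simp add: \<delta>_def)
    then have "exp (- (ln 2 / 2 + \<delta> N) * (ln (real N) / ln (ln (real N)))) = exp (- g N / 2 + ln (c / 2))"
      by (metis add.commute minus_diff_eq minus_divide_left mult_minus_left uminus_add_conv_diff)
    also have "\<dots> = exp (- g N / 2) * (c / 2)"
      using c by (subst exp_add) simp
    finally have eq: "exp (- (ln 2 / 2 + \<delta> N) * (ln (real N) / ln (ln (real N)))) =
      exp (- g N / 2) * (c / 2)" .
    show ?case unfolding eq using elim(3) by (simp add: mult_ac)
  qed

  have 2: "\<exists>C>0. \<forall>\<^sub>F N in sequentially. E N \<ge> C * real N powr (3 / 4 - \<epsilon>)" if "\<epsilon> > 0" for \<epsilon> :: real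
  proof (intro exI conjI)
    show "c / 2 > 0" using c by simp
    \<comment> \<open>The divisor factor in \<open>main\<close> thus costs at most \<open>N\<close>
      to the power epsilon, and the constant \<open>c / 2\<close> serves for every epsilon.\<close>
    have "\<forall>\<^sub>F N in sequentially. g N / 2 \<le> \<epsilon> * ln (real N)"
      unfolding g_def by (intro seq divisor_exponent_le_ln that)
    with main eventually_gt_at_top[of 0]
    show "\<forall>\<^sub>F N in sequentially. E N \<ge> c / 2 * real N powr (3 / 4 - \<epsilon>)"
    proof eventually_elim
      case (elim N)
      have "real N powr (3 / 4 - \<epsilon>) = real N powr (3 / 4) * exp (- (\<epsilon> * ln (real N)))"
        using elim(2) by (simp add: powr_def exp_add[symmetric] algebra_simps)
      also have "\<dots> \<le> real N powr (3 / 4) * exp (- g N / 2)"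
        using elim(3) by (intro mult_left_mono) auto
      finally have "c / 2 * real N powr (3 / 4 - \<epsilon>) \<le> c / 2 * (real N powr (3 / 4) * exp (- g N / 2))"
        using c by (intro mult_left_mono) auto
      then show ?case using elim(1) by (simp add: mult.assoc)
    qed
  qed
  show ?thesis using \<delta> 1 2 unfolding E_def by blast
qed

end
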